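(* Let $m\ge1$ and $r\ge2$ be integers, $B\subset\mathbb C^m$ the open Euclidean unit ball, and $V$ a complex vector space of dimension $r$. Suppose $0\le\rho_1<\rho_2<\rho$, and a metric $h$ on the trivial bundle $F'=\rho B\times V\to\rho B$ has semipositive curvature. Assume that \[ h(s,\cdot)=h(s',\cdot)\qquad\text{whenever}\quad \|s\|=\|s'\|=\rho_2 . \] Then $h(s,\cdot)\ge h(s',\cdot)$ whenever $\|s\|=\rho_1$, $\|s'\|=\rho_2$.
   Context: A hermitian metric on a finite dimensional complex vector space is a function of the form $v\mapsto\hat h(v,v)$, with $\hat h$ a positive definite hermitian form. A (hermitian) metric on a holomorphic vector bundle $E\to S$ is a function $h:E\to\mathbb R$ on the total space whose restriction to each fiber is a hermitian metric in this sense (no continuity is required a priori). The metric $h$ is seminegatively curved if $h$ is plurisubharmonic on the total space $E$; it is semipositively curved if the dual metric $h^*$ on the dual bundle $E^*$ is seminegatively curved. $\rho B=\{s\in\mathbb C^m:\|s\|<\rho\}$, with $\|\ \|$ the Euclidean norm; $h(s,\cdot)$ denotes the hermitian metric $v\mapsto h(s,v)$ on $V$. *)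

theory Defs
  imports "HOL-Analysis.Analysis" "HOL-Library.Function_Algebras"
begin

definition usc_on :: "'a::topological_space set \<Rightarrow> ('a \<Rightarrow> real) \<Rightarrow> bool" where
  "usc_on X u \<longleftrightarrow> (\<forall>c. openin (top_of_set X) {x \<in> X. u x < c})"

(* Only real-valued (never -infinity) functions are needed here.  For such functions the
   circle averages of a subharmonic function are automatically finite, so integrability is
   part of the sub-mean-value inequality and not an additional restriction; it is spelled
   out because the integral of a non-integrable function is 0 by convention. *)
definition subharmonic_on :: "complex set \<Rightarrow> (complex \<Rightarrow> real) \<Rightarrow> bool" where
  "subharmonic_on U f \<longleftrightarrow>
     usc_on U f \<and>
     (\<forall>a R. 0 < R \<longrightarrow> cball a R \<subseteq> U \<longrightarrow>
        (\<lambda>t. f (a + of_real R * cis t)) integrable_on {0..2 * pi} \<and>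
        f a \<le> 1 / (2 * pi) * integral {0..2 * pi} (\<lambda>t. f (a + of_real R * cis t)))"

(* Here sc is the multiplication by complex scalars, and X is an open subset of a
   finite-dimensional complex subspace L of 'e carrying the topology induced from 'e.
   Lines whose direction w is not in L meet X in at most one point, so they impose
   no condition. *)
definition plurisubharmonic_on ::
  "(complex \<Rightarrow> 'e \<Rightarrow> 'e) \<Rightarrow> 'e::{ab_group_add,topological_space} set \<Rightarrow> ('e \<Rightarrow> real) \<Rightarrow> bool"
where
  "plurisubharmonic_on sc X u \<longleftrightarrow>
     usc_on X u \<and>
     (\<forall>x\<in>X. \<forall>w. subharmonic_on {z. x + sc z w \<in> X} (\<lambda>z. u (x + sc z w)))"

definition hermitian_form ::
  "(complex \<Rightarrow> 'v::ab_group_add \<Rightarrow> 'v) \<Rightarrow> ('v \<Rightarrow> 'v \<Rightarrow> complex) \<Rightarrow> bool" where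
  "hermitian_form sc H \<longleftrightarrow>
     (\<forall>w. Vector_Spaces.linear sc (*) (\<lambda>v. H v w)) \<and> (\<forall>v w. H w v = cnj (H v w))"

definition hermitian_metric ::
  "(complex \<Rightarrow> 'v::ab_group_add \<Rightarrow> 'v) \<Rightarrow> ('v \<Rightarrow> real) \<Rightarrow> bool" where
  "hermitian_metric sc g \<longleftrightarrow>
     (\<exists>H. hermitian_form sc H \<and> (\<forall>v. v \<noteq> 0 \<longrightarrow> 0 < Re (H v v)) \<and>
          (\<forall>v. complex_of_real (g v) = H v v))"

(* A metric on the trivial bundle D x V, where V is the type 'v with scalar multiplication sc.
   The function h is curried; its values over points outside D are irrelevant. *)
definition bundle_metric ::
  "(complex \<Rightarrow> 'v::ab_group_add \<Rightarrow> 'v) \<Rightarrow> (complex^'m) set \<Rightarrow> (complex^'m \<Rightarrow> 'v \<Rightarrow> real) \<Rightarrow> bool"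
where
  "bundle_metric sc D h \<longleftrightarrow> (\<forall>s\<in>D. hermitian_metric sc (h s))"

definition seminegatively_curved ::
  "(complex \<Rightarrow> 'w \<Rightarrow> 'w) \<Rightarrow> (complex^'m) set \<Rightarrow> 'w::{ab_group_add,topological_space} set \<Rightarrow>
   (complex^'m \<Rightarrow> 'w \<Rightarrow> real) \<Rightarrow> bool"
where
  "seminegatively_curved sc D W g \<longleftrightarrow>
     plurisubharmonic_on (\<lambda>z (s, w). (z *s s, sc z w)) (D \<times> W) (\<lambda>(s, w). g s w)"

definition dual_space :: "(complex \<Rightarrow> 'v::ab_group_add \<Rightarrow> 'v) \<Rightarrow> ('v \<Rightarrow> complex) set" where
  "dual_space sc = {\<xi>. Vector_Spaces.linear sc (*) \<xi>}"

definition dual_scale :: "complex \<Rightarrow> ('v \<Rightarrow> complex) \<Rightarrow> 'v \<Rightarrow> complex" where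
  "dual_scale z \<xi> = (\<lambda>v. z * \<xi> v)"

definition dual_metric :: "('v::zero \<Rightarrow> real) \<Rightarrow> ('v \<Rightarrow> complex) \<Rightarrow> real" where
  "dual_metric g \<xi> = (SUP v\<in>- {0}. (cmod (\<xi> v))\<^sup>2 / g v)"

(* The function type 'v => complex carries the topology of pointwise convergence.  On the dual
   of a finite-dimensional V this induces the usual topology of a finite-dimensional
   complex vector space. *)
definition semipositively_curved ::
  "(complex \<Rightarrow> 'v::ab_group_add \<Rightarrow> 'v) \<Rightarrow> (complex^'m) set \<Rightarrow> (complex^'m \<Rightarrow> 'v \<Rightarrow> real) \<Rightarrow> bool"
where
  "semipositively_curved sc D h \<longleftrightarrow>
     seminegatively_curved dual_scale D (dual_space sc) (\<lambda>s. dual_metric (h s))"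

end

theory Submission
  imports Defs
begin

text \<open>
  For a fixed functional \<open>\<xi>\<close> the function \<open>s \<mapsto> h\<^sup>*(s, \<xi>)\<close> is subharmonic along each complex line
  through the origin, and it is constant on the sphere of radius \<open>\<rho>\<^sub>2\<close>. The maximum principle gives
  \<open>h\<^sup>*(s, \<xi>) \<le> h\<^sup>*(s', \<xi>)\<close> for \<open>\<parallel>s\<parallel> = \<rho>\<^sub>1\<close>, \<open>\<parallel>s'\<parallel> = \<rho>\<^sub>2\<close>. Duality of hermitian
  metrics reverses this inequality: test it on \<open>\<xi> = H\<^sub>s\<^sub>'(\<cdot>, v)\<close>, where \<open>H\<^sub>s\<^sub>'\<close> is the form of
  \<open>h(s', \<cdot>)\<close>.
\<close>

section \<open>Subharmonic functions\<close>

text \<open>Without a maximum, every \<open>a\<close> is beaten by some \<open>y a\<close>, so the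
  sublevel sets of the values \<open>f (y a)\<close> cover \<open>K\<close>. In a finite subcover
  the largest of these values would lie strictly below another one.\<close>

lemma usc_on_attains_sup:
  fixes f :: "'a::topological_space \<Rightarrow> real"
  assumes f: "usc_on K f" and K: "compact K" "K \<noteq> {}"
  obtains a where "a \<in> K" "\<And>x. x \<in> K \<Longrightarrow> f x \<le> f a"
proof (rule ccontr)
  assume "\<not> thesis"
  then have "\<forall>a\<in>K. \<exists>x\<in>K. f a < f x"
    using that by (meson not_le)
  then obtain y where y: "\<And>a. a \<in> K \<Longrightarrow> y a \<in> K \<and> f a < f (y a)"
    by metis
  have "\<forall>a. \<exists>T. open T \<and> {x \<in> K. f x < f (y a)} = K \<inter> T"
    using f unfolding usc_on_def openin_open by blast
  then obtain T where T: "\<And>a. open (T a)" "\<And>a. {x \<in> K. f x < f (y a)} = K \<inter> T a"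
    by metis
  have "K \<subseteq> (\<Union>a\<in>K. T a)"
    using y T by blast
  then obtain A where A: "A \<subseteq> K" "finite A" "K \<subseteq> (\<Union>a\<in>A. T a)"
    using compactE_image[OF K(1), of K T] T(1) by metis
  have "A \<noteq> {}"
    using A K by auto
  then obtain b where b: "b \<in> A" "\<And>a. a \<in> A \<Longrightarrow> f (y a) \<le> f (y b)"
    using A(2) obtains_MAX[of A "\<lambda>a. f (y a)"] by (metis Max_ge finite_imageI imageI)
  obtain a where a: "a \<in> A" "y b \<in> T a"
    using A b y by blast
  then have "f (y b) < f (y a)"
    using T(2)[of a] y A b by blast
  with b(2)[OF a(1)] show False by simp
qed

lemma usc_on_subset:
  assumes f: "usc_on X f" and sub: "Y \<subseteq> X"
  shows "usc_on Y f"
  unfolding usc_on_def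
proof
  fix c
  obtain T where "open T" and T: "{x \<in> X. f x < c} = X \<inter> T"
    using f unfolding usc_on_def openin_open by meson
  have "{x \<in> Y. f x < c} = Y \<inter> {x \<in> X. f x < c}"
    using sub by blast
  also have "\<dots> = Y \<inter> T"
    unfolding T using sub by blast
  finally show "openin (top_of_set Y) {x \<in> Y. f x < c}"
    using \<open>open T\<close> openin_open by blast
qed

text \<open>A sum is below \<open>c\<close> iff some real \<open>q\<close> separates
  \<open>f x\<close> from \<open>c - p x\<close>, which makes the sublevel set a union of relatively
  open sets.\<close>

lemma usc_on_add_continuous:
  fixes f p :: "'a::topological_space \<Rightarrow> real"
  assumes f: "usc_on X f" and p: "continuous_on X p"
  shows "usc_on X (\<lambda>x. f x + p x)"
  unfolding usc_on_def
proof
  fix c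
  have "openin (top_of_set X) {x \<in> X. p x < c - q}" for q
    using continuous_openin_preimage_gen[OF p, of "{..<c - q}"]
    by (simp add: vimage_def Int_def)
  then have "openin (top_of_set X) (\<Union>q. {x \<in> X. f x < q} \<inter> {x \<in> X. p x < c - q})"
    using f unfolding usc_on_def by blast
  moreover have "(\<Union>q. {x \<in> X. f x < q} \<inter> {x \<in> X. p x < c - q}) = {x \<in> X. f x + p x < c}"
  proof (intro equalityI subsetI)
    fix x assume x: "x \<in> {x \<in> X. f x + p x < c}"
    then show "x \<in> (\<Union>q. {x \<in> X. f x < q} \<inter> {x \<in> X. p x < c - q})"
      \<comment> \<open>The midpoint between \<open>f x\<close> and \<open>c - p x\<close> serves as
        \<open>q\<close>.\<close>
      by (intro UN_I[of "(f x + (c - p x)) / 2"]) (auto simp: field_simps)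
  qed auto
  ultimately show "openin (top_of_set X) {x \<in> X. f x + p x < c}" by simp
qed

text \<open>The mean of the squared modulus over a circle exceeds its value at the centre by exactly
  the squared radius: the strict gain exploited in the maximum principle.\<close>

lemma has_integral_norm_square_circle:
  fixes a :: complex
  shows "((\<lambda>t. (cmod (a + of_real R * cis t))\<^sup>2) has_integral 2 * pi * ((cmod a)\<^sup>2 + R\<^sup>2)) {0..2 * pi}"
proof -
  \<comment> \<open>An antiderivative; its trigonometric part is periodic, so only the linear term
    contributes.\<close>
  define P where "P t = ((cmod a)\<^sup>2 + R\<^sup>2) * t + 2 * R * (Re a * sin t - Im a * cos t)" for t
  have eq: "(cmod (a + of_real R * cis t))\<^sup>2 =
      (cmod a)\<^sup>2 + R\<^sup>2 + 2 * R * (Re a * cos t + Im a * sin t)" for t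
    unfolding cmod_power2 by simp (use sin_cos_squared_add[of t] in algebra)
  have "((\<lambda>t. (cmod (a + of_real R * cis t))\<^sup>2) has_integral P (2 * pi) - P 0) {0..2 * pi}"
    unfolding eq P_def
    by (rule fundamental_theorem_of_calculus)
       (auto intro!: derivative_eq_intros
          simp flip: has_real_derivative_iff_has_vector_derivative)
  then show ?thesis
    by (simp add: P_def mult.commute)
qed

lemma subharmonic_on_maximum_principle:
  assumes f: "subharmonic_on U f" and U: "cball 0 R \<subseteq> U"
    and bd: "\<And>z. cmod z = R \<Longrightarrow> f z \<le> c"
    and z: "cmod z \<le> R"
  shows "f z \<le> c"
proof -
  have R: "0 \<le> R"
    using z norm_ge_zero[of z] by linarith
  have perturbed: "f z \<le> c + \<epsilon> * R\<^sup>2" if \<epsilon>: "\<epsilon> > 0" for \<epsilon>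
  proof -
    \<comment> \<open>The perturbation makes the sub-mean-value inequality strict, so the maximum cannot be
      attained in the interior.\<close>
    define g where "g w = f w + \<epsilon> * (cmod w)\<^sup>2" for w
    have "usc_on (cball 0 R) f"
      using f U unfolding subharmonic_on_def by (blast intro: usc_on_subset)
    then have "usc_on (cball 0 R) g"
      unfolding g_def by (rule usc_on_add_continuous) (intro continuous_intros)
    then obtain a where a: "a \<in> cball 0 R" and max: "\<And>w. w \<in> cball 0 R \<Longrightarrow> g w \<le> g a"
      using usc_on_attains_sup[of "cball 0 R" g] R by (metis compact_cball cball_eq_empty not_le)
    have "cmod a = R"
    proof (rule ccontr)
      assume "cmod a \<noteq> R"
      \<comment> \<open>The radius of the largest disc about \<open>a\<close> inside
        \<open>cball 0 R\<close>.\<close>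
      define d where "d = R - cmod a"
      have d: "d > 0"
        using a \<open>cmod a \<noteq> R\<close> by (simp add: d_def)
      have sub: "cball a d \<subseteq> cball 0 R"
        by (simp add: d_def cball_subset_cball_iff)
      let ?F = "\<lambda>t. f (a + of_real d * cis t)"
      have int: "?F integrable_on {0..2 * pi}"
        and le: "f a \<le> 1 / (2 * pi) * integral {0..2 * pi} ?F"
        using f d sub U unfolding subharmonic_on_def by blast+
      have "((\<lambda>t. g a - \<epsilon> * (cmod (a + of_real d * cis t))\<^sup>2) has_integral
          2 * pi * g a - \<epsilon> * (2 * pi * ((cmod a)\<^sup>2 + d\<^sup>2))) {0..2 * pi}"
        using has_integral_diff[OF has_integral_const_real[of "g a" 0 "2 * pi"]
            has_integral_mult_right[OF has_integral_norm_square_circle[of a d], of \<epsilon>]]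
        by simp
      moreover have "?F t \<le> g a - \<epsilon> * (cmod (a + of_real d * cis t))\<^sup>2" for t
      proof -
        have "a + of_real d * cis t \<in> cball a d"
          using d by (simp add: dist_norm norm_mult)
        then have "g (a + of_real d * cis t) \<le> g a"
          using sub max by blast
        then show ?thesis by (simp add: g_def)
      qed
      ultimately have "integral {0..2 * pi} ?F \<le> 2 * pi * g a - \<epsilon> * (2 * pi * ((cmod a)\<^sup>2 + d\<^sup>2))"
        using has_integral_le[OF integrable_integral[OF int]] by blast
      \<comment> \<open>The perturbation term at \<open>a\<close> cancels; the remaining deficit
        \<open>\<epsilon> * d\<^sup>2\<close> contradicts the sub-mean-value inequality.\<close>
      also have "\<dots> = 2 * pi * (f a - \<epsilon> * d\<^sup>2)"
        by (simp add: g_def algebra_simps)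
      finally have "1 / (2 * pi) * integral {0..2 * pi} ?F \<le> f a - \<epsilon> * d\<^sup>2"
        by (simp add: field_simps)
      with le have "\<epsilon> * d\<^sup>2 \<le> 0" by linarith
      with \<epsilon> d show False by (simp add: mult_le_0_iff)
    qed
    then have "g a \<le> c + \<epsilon> * R\<^sup>2"
      using bd by (simp add: g_def)
    moreover have "g z \<le> g a"
      using z max by simp
    moreover have "f z \<le> g z"
      using \<epsilon> by (simp add: g_def)
    ultimately show ?thesis by linarith
  qed
  show ?thesis
  proof (rule field_le_epsilon)
    fix e :: real assume "0 < e"
    \<comment> \<open>The \<open>+ 1\<close> keeps the denominator positive even for
      \<open>R = 0\<close>.\<close>
    have "f z \<le> c + e / (R\<^sup>2 + 1) * R\<^sup>2"
      using \<open>0 < e\<close> by (intro perturbed divide_pos_pos) (auto simp: add_nonneg_pos)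
    also have "e / (R\<^sup>2 + 1) * R\<^sup>2 \<le> e"
      using \<open>0 < e\<close> mult_left_mono[of "R\<^sup>2 / (R\<^sup>2 + 1)" 1 e]
      by (simp add: divide_le_eq_1 add_nonneg_pos)
    finally show "f z \<le> c + e" by simp
  qed
qed

section \<open>Hermitian metrics and their duals\<close>

locale pos_def_hermitian = vector_space scale
  for scale :: "complex \<Rightarrow> 'v::ab_group_add \<Rightarrow> 'v" +
  fixes H :: "'v \<Rightarrow> 'v \<Rightarrow> complex"
  assumes form: "hermitian_form scale H"
    and pos: "v \<noteq> 0 \<Longrightarrow> 0 < Re (H v v)"
begin

lemma linear_left: "Vector_Spaces.linear scale (*) (\<lambda>v. H v w)"
  using form unfolding hermitian_form_def by blast

lemma form_cnj: "H w v = cnj (H v w)"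
  using form unfolding hermitian_form_def by blast

lemma add_left: "H (x + y) w = H x w + H y w"
  by (rule Vector_Spaces.linear.axioms(3)[OF linear_left, THEN module_hom.add])

lemma scale_left: "H (scale c x) w = c * H x w"
  by (rule Vector_Spaces.linear.axioms(3)[OF linear_left, THEN module_hom.scale])

lemma add_right: "H w (x + y) = H w x + H w y"
  by (simp add: form_cnj[of w] add_left)

lemma scale_right: "H w (scale c x) = cnj c * H w x"
  by (simp add: form_cnj[of w] scale_left)

lemma diff_left: "H (x - y) w = H x w - H y w"
  using add_left[of "x - y" y w] by simp

lemma diff_right: "H w (x - y) = H w x - H w y"
  using add_right[of w "x - y" y] by simp

lemma zero_left [simp]: "H 0 w = 0"
  using diff_left[of 0 0 w] by simp

lemma zero_right [simp]: "H w 0 = 0"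
  using diff_right[of w 0 0] by simp

lemma form_real: "H v v = of_real (Re (H v v))"
  using arg_cong[OF form_cnj[of v v], of Im] by (simp add: complex_eq_iff)

lemma nonneg: "0 \<le> Re (H v v)"
  using pos[of v] by (cases "v = 0") auto

text \<open>This is nonnegativity of \<open>H u u\<close>, where \<open>u\<close> is
  \<open>b\<close> times the component of \<open>v\<close> orthogonal to \<open>w\<close>; the
  factor \<open>b = Re (H w w)\<close> avoids division.\<close>

lemma Cauchy_Schwarz: "(cmod (H v w))\<^sup>2 \<le> Re (H v v) * Re (H w w)"
proof (cases "w = 0")
  case False
  define b where "b = Re (H w w)"
  have b: "b > 0" "H w w = of_real b"
    unfolding b_def by (rule pos[OF False], rule form_real)
  define u where "u = scale (of_real b) v - scale (H v w) w"
  have "H u u = of_real b * (of_real b * H v v - H v w * cnj (H v w))"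
    unfolding u_def diff_left diff_right scale_left scale_right b(2) form_cnj[of w v]
    by (simp add: algebra_simps)
  also have "\<dots> = of_real (b * (b * Re (H v v) - (cmod (H v w))\<^sup>2))"
    by (subst form_real) (simp flip: complex_norm_square)
  finally have "H u u = of_real (b * (b * Re (H v v) - (cmod (H v w))\<^sup>2))" .
  with nonneg[of u] have "0 \<le> b * (b * Re (H v v) - (cmod (H v w))\<^sup>2)"
    by simp
  with b(1) have "(cmod (H v w))\<^sup>2 \<le> b * Re (H v v)"
    by (simp add: zero_le_mult_iff)
  then show ?thesis
    by (simp add: b_def mult.commute)
qed simp

text \<open>Gram-Schmidt by induction on \<open>B\<close>: the new vector \<open>b\<close> is
  replaced by its part \<open>q\<close> orthogonal to the old span, and the representing vector is
  corrected by a multiple of \<open>q\<close>.\<close>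

lemma Riesz_on_finite_span:
  assumes "finite B" "Vector_Spaces.linear scale (*) \<xi>"
  obtains u where "u \<in> span B" "\<And>w. w \<in> span B \<Longrightarrow> \<xi> w = H w u"
proof -
  have "\<exists>u\<in>span B. \<forall>w\<in>span B. \<xi> w = H w u"
    using assms
  proof (induction B arbitrary: \<xi> rule: finite_induct)
    case empty
    interpret \<xi>: Vector_Spaces.linear scale "(*)" \<xi> by fact
    show ?case by (auto simp: \<xi>.zero)
  next
    case (insert b B)
    interpret \<xi>: Vector_Spaces.linear scale "(*)" \<xi> by fact
    obtain u where u: "u \<in> span B" "\<And>w. w \<in> span B \<Longrightarrow> \<xi> w = H w u"
      using insert.IH[OF insert.prems] by blast
    \<comment> \<open>The induction hypothesis for the functional \<open>\<lambda>v. H v b\<close>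
      yields the orthogonal projection \<open>p\<close> of \<open>b\<close> onto
      \<open>span B\<close>.\<close>
    obtain p where p: "p \<in> span B" "\<And>w. w \<in> span B \<Longrightarrow> H w b = H w p"
      using insert.IH[OF linear_left[of b]] by blast
    define q where "q = b - p"
    have orth: "H w q = 0" if "w \<in> span B" for w
      using p(2)[OF that] by (simp add: q_def diff_right)
    have span: "\<exists>k. w - scale k q \<in> span B" if "w \<in> span (insert b B)" for w
    proof -
      obtain k where "w - scale k b \<in> span B"
        using \<open>w \<in> span (insert b B)\<close> span_breakdown_eq by blast
      then have "w - scale k b + scale k p \<in> span B"
        using p(1) by (intro span_add span_scale)
      then show ?thesis
        by (intro exI[of _ k]) (simp add: q_def algebra_simps scale_right_diff_distrib)
    qed
    \<comment> \<open>Solves \<open>\<xi> q = H q (u + scale c q)\<close>, with a conjugate because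
      \<open>H\<close> is conjugate linear on the right. If \<open>b\<close> already lies in
      \<open>span B\<close>, then \<open>q = 0\<close> and both sides vanish for any
      \<open>c\<close>.\<close>
    define c where "c = cnj ((\<xi> q - H q u) / H q q)"
    have sub: "span B \<subseteq> span (insert b B)"
      by (intro span_mono) auto
    have q: "\<xi> q = H q u + cnj c * H q q"
    proof (cases "q = 0")
      case True
      then show ?thesis by (simp add: \<xi>.zero)
    next
      case False
      then have "H q q \<noteq> 0" using pos[of q] by auto
      then show ?thesis by (simp add: c_def)
    qed
    show ?case
    proof (intro bexI ballI)
      show "u + scale c q \<in> span (insert b B)"
        using u(1) p(1) sub unfolding q_def
        by (intro span_add span_scale span_diff) (auto intro: span_base)
      fix w assume "w \<in> span (insert b B)"
      then obtain k where k: "w - scale k q \<in> span B"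
        using span by blast
      have "\<xi> (w - scale k q) = H (w - scale k q) (u + scale c q)"
        using u(2)[OF k] orth[OF k] by (simp add: add_right scale_right)
      moreover have "\<xi> q = H q (u + scale c q)"
        using q by (simp add: add_right scale_right)
      ultimately show "\<xi> w = H w (u + scale c q)"
        by (simp add: \<xi>.diff \<xi>.scale diff_left scale_left)
    qed
  qed
  then show thesis using that by blast
qed

end

lemma hermitian_metricE:
  fixes sc :: "complex \<Rightarrow> 'v::ab_group_add \<Rightarrow> 'v"
  assumes "vector_space sc" "hermitian_metric sc g"
  obtains H where "pos_def_hermitian sc H" "\<And>v. H v v = complex_of_real (g v)"
proof -
  obtain H where "hermitian_form sc H" "\<And>v. v \<noteq> 0 \<Longrightarrow> 0 < Re (H v v)"
    and eq: "\<And>v. complex_of_real (g v) = H v v"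
    using assms(2) unfolding hermitian_metric_def by blast
  then have "pos_def_hermitian sc H"
    using assms(1) by (intro pos_def_hermitian.intro pos_def_hermitian_axioms.intro)
  then show thesis
    by (rule that) (rule eq[symmetric])
qed

text \<open>A real supremum dominates its members only if they are bounded above. Finite dimension
  gives \<open>\<xi> w = H w u\<close> for some \<open>u\<close>, and Cauchy-Schwarz then bounds the
  quotients by \<open>g u\<close>.\<close>

lemma le_dual_metric:
  fixes sc :: "complex \<Rightarrow> 'v::ab_group_add \<Rightarrow> 'v"
  assumes V: "vector_space sc" and B: "finite B" "module.span sc B = UNIV"
    and g: "hermitian_metric sc g" and \<xi>: "\<xi> \<in> dual_space sc" and v: "v \<noteq> 0"
  shows "(cmod (\<xi> v))\<^sup>2 / g v \<le> dual_metric g \<xi>"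
proof -
  obtain H where H: "pos_def_hermitian sc H" and eq: "\<And>v. H v v = complex_of_real (g v)"
    using hermitian_metricE[OF V g] by blast
  interpret pos_def_hermitian sc H by fact
  obtain u where u: "\<And>w. \<xi> w = H w u"
    using Riesz_on_finite_span[OF B(1), of \<xi>] \<xi> B(2) by (auto simp: dual_space_def)
  have "(cmod (\<xi> w))\<^sup>2 / g w \<le> g u" if "w \<noteq> 0" for w
    using Cauchy_Schwarz[of w u] pos[OF that] by (simp add: u eq divide_le_eq mult.commute)
  then have "bdd_above ((\<lambda>v. (cmod (\<xi> v))\<^sup>2 / g v) ` (- {0}))"
    by (intro bdd_aboveI2) auto
  then show ?thesis
    unfolding dual_metric_def using v by (intro cSUP_upper) auto
qed

text \<open>For the test functional, the quotient at \<open>v\<close> bounds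
  \<open>dual_metric g \<xi>\<close> below by \<open>(g' v)\<^sup>2 / g v\<close>, and
  Cauchy-Schwarz for \<open>H'\<close> bounds \<open>dual_metric g' \<xi>\<close> above by
  \<open>g' v\<close>. Cancelling \<open>g' v\<close> gives the claim.\<close>

lemma hermitian_metric_le_if_dual_metric_le:
  fixes sc :: "complex \<Rightarrow> 'v::ab_group_add \<Rightarrow> 'v"
  assumes V: "vector_space sc" and B: "finite B" "module.span sc B = UNIV"
    and g: "hermitian_metric sc g" and g': "hermitian_metric sc g'"
    and le: "\<And>\<xi>. \<xi> \<in> dual_space sc \<Longrightarrow> dual_metric g \<xi> \<le> dual_metric g' \<xi>"
  shows "g' v \<le> g v"
proof (cases "v = 0")
  case True
  obtain H where H: "pos_def_hermitian sc H" "\<And>v. H v v = complex_of_real (g v)"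
    using hermitian_metricE[OF V g] by blast
  obtain H' where H': "pos_def_hermitian sc H'" "\<And>v. H' v v = complex_of_real (g' v)"
    using hermitian_metricE[OF V g'] by blast
  show ?thesis
    using True H(2)[of 0] H'(2)[of 0] pos_def_hermitian.zero_left[OF H(1)]
      pos_def_hermitian.zero_left[OF H'(1)] by simp
next
  case False
  obtain H where H: "pos_def_hermitian sc H" "\<And>v. H v v = complex_of_real (g v)"
    using hermitian_metricE[OF V g] by blast
  obtain H' where H': "pos_def_hermitian sc H'" "\<And>v. H' v v = complex_of_real (g' v)"
    using hermitian_metricE[OF V g'] by blast
  interpret H: pos_def_hermitian sc H by fact
  interpret H': pos_def_hermitian sc H' by fact
  have pos: "g v > 0" "g' v > 0"
    using H.pos[OF False] H'.pos[OF False] by (auto simp: H H')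
  define \<xi> where "\<xi> w = H' w v" for w
  have \<xi>: "\<xi> \<in> dual_space sc"
    using H'.linear_left by (simp add: \<xi>_def[abs_def] dual_space_def)
  have "(g' v)\<^sup>2 / g v = (cmod (\<xi> v))\<^sup>2 / g v"
    by (simp add: \<xi>_def H')
  also have "\<dots> \<le> dual_metric g \<xi>"
    by (rule le_dual_metric[OF V B g \<xi> False])
  also have "\<dots> \<le> dual_metric g' \<xi>"
    by (rule le[OF \<xi>])
  also have "\<dots> \<le> g' v"
    unfolding dual_metric_def
  proof (rule cSUP_least)
    show "- {0 :: 'v} \<noteq> {}" using False by blast
    fix w :: 'v assume "w \<in> - {0}"
    then show "(cmod (\<xi> w))\<^sup>2 / g' w \<le> g' v"
      using H'.Cauchy_Schwarz[of w v] H'.pos[of w]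
      by (simp add: \<xi>_def H' divide_le_eq mult.commute)
  qed
  finally show ?thesis
    using pos by (simp add: divide_le_eq power2_eq_square)
qed

section \<open>Restriction to lines through the origin\<close>

lemma norm_vector_scalar_mult: "norm (z *s x) = cmod z * norm x" for x :: "complex^'m"
  by (simp add: norm_vec_def vector_scalar_mult_def norm_mult L2_set_right_distrib)

text \<open>Plurisubharmonicity on the total space is applied at the point \<open>(0, \<xi>)\<close>
  in the horizontal direction \<open>(e, 0)\<close>, so the dual vector stays fixed; as
  \<open>e\<close> is a unit vector, the slice is the full disc of radius
  \<open>\<rho>\<close>.\<close>

lemma semipositively_curved_subharmonic_on_line:
  fixes sc :: "complex \<Rightarrow> 'v::ab_group_add \<Rightarrow> 'v"
    and e :: "complex^'m"
  assumes curv: "semipositively_curved sc (ball 0 \<rho>) h" and \<rho>: "0 < \<rho>"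
    and e: "norm e = 1" and \<xi>: "\<xi> \<in> dual_space sc"
  shows "subharmonic_on (ball 0 \<rho>) (\<lambda>z. dual_metric (h (z *s e)) \<xi>)"
proof -
  have "(0, \<xi>) \<in> ball 0 \<rho> \<times> dual_space sc"
    using \<rho> \<xi> by simp
  moreover have "dual_scale z (0 :: 'v \<Rightarrow> complex) = 0" for z
    by (simp add: dual_scale_def fun_eq_iff)
  moreover have "{z. z *s e \<in> ball 0 \<rho>} = ball 0 \<rho>"
    using e by (auto simp: norm_vector_scalar_mult)
  moreover have "subharmonic_on
      {z. (0, \<xi>) + (case (e, 0) of (s, w) \<Rightarrow> (z *s s, dual_scale z w)) \<in> ball 0 \<rho> \<times> dual_space sc}
      (\<lambda>z. case (0, \<xi>) + (case (e, 0) of (s, w) \<Rightarrow> (z *s s, dual_scale z w)) of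
        (s, w) \<Rightarrow> dual_metric (h s) w)"
    using curv calculation(1)
    unfolding semipositively_curved_def seminegatively_curved_def plurisubharmonic_on_def
    by blast
  ultimately show ?thesis
    using \<xi> by simp
qed

theorem lemma4p3:
  fixes scale :: "complex \<Rightarrow> 'v::ab_group_add \<Rightarrow> 'v"
    and r :: nat
    and \<rho>\<^sub>1 \<rho>\<^sub>2 \<rho> :: real
    and h :: "complex^'m \<Rightarrow> 'v \<Rightarrow> real"
  assumes V: "vector_space scale"
    and dim_V: "vector_space.dim scale (UNIV :: 'v set) = r" and r: "2 \<le> r"
    and \<rho>: "0 \<le> \<rho>\<^sub>1" "\<rho>\<^sub>1 < \<rho>\<^sub>2" "\<rho>\<^sub>2 < \<rho>"
    and metric: "bundle_metric scale (ball 0 \<rho>) h"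
    and curv: "semipositively_curved scale (ball 0 \<rho>) h"
    and const: "\<And>s s' v. norm s = \<rho>\<^sub>2 \<Longrightarrow> norm s' = \<rho>\<^sub>2 \<Longrightarrow> h s v = h s' v"
  shows "\<forall>s s' v. norm s = \<rho>\<^sub>1 \<longrightarrow> norm s' = \<rho>\<^sub>2 \<longrightarrow> h s' v \<le> h s v"
proof (intro allI impI)
  fix s s' :: "complex^'m" and v
  assume s: "norm s = \<rho>\<^sub>1" and s': "norm s' = \<rho>\<^sub>2"
  interpret vector_space scale by fact
  obtain B where B: "UNIV \<subseteq> span B" "card B = dim UNIV"
    using basis_exists[of UNIV] by metis
  \<comment> \<open>Infinite sets have \<open>card\<close> 0, so a positive \<open>r\<close> forces
    finiteness.\<close>
  have "finite B"
    using B(2) dim_V r by (intro card_ge_0_finite) simp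
  obtain e :: "complex^'m" and z0 where e: "norm e = 1" and z0: "s = z0 *s e"
  proof (cases "s = 0")
    \<comment> \<open>The origin lies on every line; any coordinate vector serves as
      \<open>e\<close>.\<close>
    case True
    show thesis
      by (rule that[of "axis undefined 1" 0]) (auto simp: True)
  next
    case False
    show thesis
    proof (rule that)
      show "norm (of_real (inverse (norm s)) *s s) = 1"
        using False by (simp add: norm_vector_scalar_mult norm_inverse)
      show "s = of_real (norm s) *s (of_real (inverse (norm s)) *s s)"
        using False by (simp add: vector_smult_assoc flip: of_real_mult)
    qed
  qed
  have le: "dual_metric (h s) \<xi> \<le> dual_metric (h s') \<xi>" if \<xi>: "\<xi> \<in> dual_space scale" for \<xi>
    unfolding z0
  proof (rule subharmonic_on_maximum_principle)
    show "subharmonic_on (ball 0 \<rho>) (\<lambda>z. dual_metric (h (z *s e)) \<xi>)"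
      using \<rho> by (intro semipositively_curved_subharmonic_on_line[OF curv _ e \<xi>]) simp
    show "cball 0 \<rho>\<^sub>2 \<subseteq> ball 0 \<rho>"
      using \<rho> by auto
    show "cmod z0 \<le> \<rho>\<^sub>2"
      using s e \<rho> by (simp add: z0 norm_vector_scalar_mult)
    \<comment> \<open>The circle of radius \<open>\<rho>\<^sub>2\<close> in the line lies on the
      sphere where \<open>h\<close> is constant, so the bound there is an equality.\<close>
    fix z assume "cmod z = \<rho>\<^sub>2"
    then have "h (z *s e) = h s'"
      using e s' by (intro ext const) (simp_all add: norm_vector_scalar_mult)
    then show "dual_metric (h (z *s e)) \<xi> \<le> dual_metric (h s') \<xi>"
      by simp
  qed
  have "hermitian_metric scale (h s)" "hermitian_metric scale (h s')"
    using metric s s' \<rho> by (auto simp: bundle_metric_def)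
  moreover have "span B = UNIV"
    using B(1) by blast
  ultimately show "h s' v \<le> h s v"
    using hermitian_metric_le_if_dual_metric_le[OF V \<open>finite B\<close>] le by blast
qed

end
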